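(* Let $\rho:WB_3\to GL_3(\mathbb{C})$ be a $3$-dimensional representation of the welded braid group $WB_3$ such that its restriction $\rho|_{B_3}$ to the braid group $B_3$ is equivalent to a specialization $\tau_3(z)$ of the standard representation for some $z\in\mathbb{C}^*$, $z\neq 1$. Then exactly one of the following is true: 1) There exists a unique pair $(\lambda,k)$, where $\lambda\in\mathbb{C}^*$ and $k\in\{-1,1\}$, such that $\rho$ is equivalent to $X_3(1,k)\otimes\widetilde{\tau}_3(z,\lambda)$. 2) There exists a unique triple $(\lambda,k,x)$, where $k\in\{-1,1\}$, $\lambda\in\mathbb{C}^*$, $\lambda\neq 1$, and $x\in\mathbb{C}^*$, $x^3=\frac{1}{z^2}$, such that $\rho$ is equivalent to $X_3(1,k)\otimes\psi_3(z,\lambda;x)$.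
   Context: The welded braid group $WB_3$ is generated by $\alpha_1,\alpha_2,\sigma_1,\sigma_2$ with defining relations $\alpha_1^2=\alpha_2^2=1$, $\alpha_1\alpha_2\alpha_1=\alpha_2\alpha_1\alpha_2$, $\sigma_1\sigma_2\sigma_1=\sigma_2\sigma_1\sigma_2$, $\alpha_1\alpha_2\sigma_1=\sigma_2\alpha_1\alpha_2$, $\sigma_1\sigma_2\alpha_1=\alpha_2\sigma_1\sigma_2$. The subgroup generated by $\sigma_1,\sigma_2$ is isomorphic to the braid group on 3 strings and is denoted $B_3$. Matrices act on column vectors. For $k\in\{-1,1\}$, $X_3(1,k):WB_3\to\mathbb{C}^*$ is the one-dimensional representation $\sigma_i\mapsto 1$, $\alpha_i\mapsto k$. For $z\in\mathbb{C}^*$, $\tau_3(z):B_3\to GL_3(\mathbb{C})$ is $$\tau_3(z)(\sigma_1)=\begin{pmatrix}0&z&0\\1&0&0\\0&0&1\end{pmatrix},\quad \tau_3(z)(\sigma_2)=\begin{pmatrix}1&0&0\\0&0&z\\0&1&0\end{pmatrix}.$$ For $z,\lambda\in\mathbb{C}^*$, $\widetilde{\tau}_3(z,\lambda):WB_3\to GL_3(\mathbb{C})$ is the representation with $\widetilde{\tau}_3(z,\lambda)(\sigma_i)=\tau_3(z)(\sigma_i)$ and $$\widetilde{\tau}_3(z,\lambda)(\alpha_1)=\begin{pmatrix}0&\frac1\lambda&0\\ \lambda&0&0\\0&0&1\end{pmatrix},\quad \widetilde{\tau}_3(z,\lambda)(\alpha_2)=\begin{pmatrix}1&0&0\\0&0&\frac1\lambda\\0&\lambda&0\end{pmatrix}.$$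 For $z,\lambda,x\in\mathbb{C}^*$ with $x^3=\frac1{z^2}$, $\psi_3(z,\lambda;x):WB_3\to GL_3(\mathbb{C})$ is the representation with $\psi_3(z,\lambda;x)(\sigma_i)=\tau_3(z)(\sigma_i)$ and $$\psi_3(z,\lambda;x)(\alpha_1)=\begin{pmatrix}a&\frac bx&\frac c{x^2}\\ xb&c&\frac ax\\ x^2c&xa&b\end{pmatrix},\quad \psi_3(z,\lambda;x)(\alpha_2)=\begin{pmatrix}b&\frac cx&\frac a{x^2}\\ xc&a&\frac bx\\ x^2a&xb&c\end{pmatrix},$$ where, with $\omega$ the primitive cubic root of unity, $a=\frac{\omega}{3}\lambda+\frac13+\frac{\omega^2}{3}\lambda^{-1}$, $b=\frac13\lambda+\frac13+\frac13\lambda^{-1}$, $c=\frac{\omega^2}{3}\lambda+\frac13+\frac{\omega}{3}\lambda^{-1}$. *)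

theory Defs
  imports "HOL-Analysis.Analysis" "HOL-Algebra.Generated_Groups"
begin

section \<open>Groups given by generators and relations\<close>

text \<open>A letter is a generator together with a sign: \<open>(g, True)\<close> stands for $g$ and
  \<open>(g, False)\<close> for $g^{-1}$. A relation $u = v$ is the pair \<open>(u, v)\<close> of words.\<close>

type_synonym 'g word = "('g \<times> bool) list"

inductive pres_eq :: "('g word \<times> 'g word) set \<Rightarrow> 'g word \<Rightarrow> 'g word \<Rightarrow> bool"
  for R :: "('g word \<times> 'g word) set"
where
  refl: "pres_eq R u u"
| sym: "pres_eq R u v \<Longrightarrow> pres_eq R v u"
| trans: "pres_eq R u v \<Longrightarrow> pres_eq R v w \<Longrightarrow> pres_eq R u w"
| append: "pres_eq R u u' \<Longrightarrow> pres_eq R v v' \<Longrightarrow> pres_eq R (u @ v) (u' @ v')"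
| cancel: "pres_eq R [(g, e), (g, \<not> e)] []"
| relation: "(u, v) \<in> R \<Longrightarrow> pres_eq R u v"

definition pres_class :: "('g word \<times> 'g word) set \<Rightarrow> 'g word \<Rightarrow> 'g word set" where
  "pres_class R w = {v. pres_eq R w v}"

definition presented_group :: "('g word \<times> 'g word) set \<Rightarrow> 'g word set monoid" where
  "presented_group R =
    \<lparr>carrier = range (pres_class R),
     mult = (\<lambda>A B. \<Union>a\<in>A. \<Union>b\<in>B. pres_class R (a @ b)),
     one = pres_class R []\<rparr>"

definition eval_word :: "('h, 'x) monoid_scheme \<Rightarrow> ('g \<Rightarrow> 'h) \<Rightarrow> 'g word \<Rightarrow> 'h" where
  "eval_word H f w =
    foldr (\<lambda>(g, e) y. (if e then f g else inv\<^bsub>H\<^esub> f g) \<otimes>\<^bsub>H\<^esub> y) w \<one>\<^bsub>H\<^esub>"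

lemma pres_class_eq_iff: "pres_class R u = pres_class R v \<longleftrightarrow> pres_eq R u v"
  unfolding pres_class_def set_eq_iff mem_Collect_eq
  by (meson pres_eq.refl pres_eq.sym pres_eq.trans)

lemma mult_pres_class:
  "pres_class R u \<otimes>\<^bsub>presented_group R\<^esub> pres_class R v = pres_class R (u @ v)"
proof -
  have "pres_class R (a @ b) = pres_class R (u @ v)"
    if "a \<in> pres_class R u" "b \<in> pres_class R v" for a b
  proof -
    have "pres_eq R a u" "pres_eq R b v"
      using that by (simp_all add: pres_class_def pres_eq.sym)
    then show ?thesis unfolding pres_class_eq_iff by (rule pres_eq.append)
  qed
  then have "(\<Union>a\<in>pres_class R u. \<Union>b\<in>pres_class R v. pres_class R (a @ b)) =
      (\<Union>a\<in>pres_class R u. \<Union>b\<in>pres_class R v. pres_class R (u @ v))"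
    by (intro SUP_cong HOL.refl)
  moreover have "pres_class R u \<noteq> {}" "pres_class R v \<noteq> {}"
    using pres_eq.refl by (auto simp: pres_class_def)
  ultimately show ?thesis by (simp add: presented_group_def)
qed

lemma pres_eq_inverse:
  "pres_eq R (rev (map (\<lambda>(g, e). (g, \<not> e)) w) @ w) []"
proof (induction w)
  case Nil
  show ?case by (simp add: pres_eq.refl)
next
  case (Cons l w)
  obtain g e where l: "l = (g, e)" by (cases l)
  let ?v = "rev (map (\<lambda>(g, e). (g, \<not> e)) w)"
  have "pres_eq R ([(g, \<not> e), (g, e)] @ w) ([] @ w)"
    using pres_eq.cancel[of R g "\<not> e"] by (intro pres_eq.append pres_eq.refl) simp
  then have "pres_eq R (?v @ ([(g, \<not> e), (g, e)] @ w)) (?v @ w)"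
    by (intro pres_eq.append pres_eq.refl) simp
  then show ?case using Cons.IH by (auto simp: l intro: pres_eq.trans)
qed

lemma group_presented_group: "group (presented_group R)"
proof (rule groupI)
  have c: "carrier (presented_group R) = range (pres_class R)"
    and o: "\<one>\<^bsub>presented_group R\<^esub> = pres_class R []"
    by (simp_all add: presented_group_def)
  show "\<one>\<^bsub>presented_group R\<^esub> \<in> carrier (presented_group R)" by (simp add: c o)
  fix x y z
  assume "x \<in> carrier (presented_group R)"
  then obtain u where u: "x = pres_class R u" by (auto simp: c)
  show "\<one>\<^bsub>presented_group R\<^esub> \<otimes>\<^bsub>presented_group R\<^esub> x = x"
    by (simp add: o u mult_pres_class)
  show "\<exists>y\<in>carrier (presented_group R). y \<otimes>\<^bsub>presented_group R\<^esub> x = \<one>\<^bsub>presented_group R\<^esub>"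
  proof
    show "pres_class R (rev (map (\<lambda>(g, e). (g, \<not> e)) u)) \<otimes>\<^bsub>presented_group R\<^esub> x =
        \<one>\<^bsub>presented_group R\<^esub>"
      unfolding u o mult_pres_class pres_class_eq_iff by (rule pres_eq_inverse)
  qed (simp add: c)
  assume "y \<in> carrier (presented_group R)"
  then obtain v where v: "y = pres_class R v" by (auto simp: c)
  show "x \<otimes>\<^bsub>presented_group R\<^esub> y \<in> carrier (presented_group R)"
    by (simp add: u v c mult_pres_class)
  assume "z \<in> carrier (presented_group R)"
  then obtain w where w: "z = pres_class R w" by (auto simp: c)
  show "x \<otimes>\<^bsub>presented_group R\<^esub> y \<otimes>\<^bsub>presented_group R\<^esub> z =
        x \<otimes>\<^bsub>presented_group R\<^esub> (y \<otimes>\<^bsub>presented_group R\<^esub> z)"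
    by (simp add: u v w mult_pres_class)
qed

context group
begin

lemma eval_word_closed:
  assumes "\<And>g. f g \<in> carrier G" shows "eval_word G f w \<in> carrier G"
  by (induction w) (auto simp: eval_word_def assms)

lemma eval_word_append:
  assumes "\<And>g. f g \<in> carrier G"
  shows "eval_word G f (u @ v) = eval_word G f u \<otimes> eval_word G f v"
proof (induction u)
  case Nil
  then show ?case using eval_word_closed[of f v, OF assms] by (simp add: eval_word_def)
next
  case (Cons l u)
  obtain g e where l: "l = (g, e)" by (cases l)
  have *: "eval_word G f (l # w) = (if e then f g else inv f g) \<otimes> eval_word G f w" for w
    by (simp add: eval_word_def l)
  show ?case
    using eval_word_closed[of f, OF assms] assms by (simp add: * Cons m_assoc)
qed

lemma eval_word_pres_eq:
  assumes "\<And>g. f g \<in> carrier G"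
    and "\<And>u v. (u, v) \<in> R \<Longrightarrow> eval_word G f u = eval_word G f v"
    and "pres_eq R u v"
  shows "eval_word G f u = eval_word G f v"
  using assms(3)
proof induction
  case (cancel g e)
  then show ?case using assms(1) by (simp add: eval_word_def)
qed (auto simp: assms(2) eval_word_append[of f, OF assms(1)])

text \<open>The universal property of the presented group.\<close>

lemma presented_group_hom:
  assumes "\<And>g. f g \<in> carrier G"
    and "\<And>u v. (u, v) \<in> R \<Longrightarrow> eval_word G f u = eval_word G f v"
  obtains h where "h \<in> hom (presented_group R) G"
    and "\<And>g. h (pres_class R [(g, True)]) = f g"
proof -
  define h where "h A = eval_word G f (SOME w. pres_class R w = A)" for A
  have h: "h (pres_class R w) = eval_word G f w" for w
  proof -
    have "pres_class R (SOME v. pres_class R v = pres_class R w) = pres_class R w"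
      by (rule someI) simp
    then show ?thesis
      unfolding h_def pres_class_eq_iff using eval_word_pres_eq[of f R, OF assms] by blast
  qed
  show thesis
  proof
    have c: "carrier (presented_group R) = range (pres_class R)"
      by (simp add: presented_group_def)
    show "h \<in> hom (presented_group R) G"
      using eval_word_closed[of f, OF assms(1)] eval_word_append[of f, OF assms(1)]
      by (auto simp: hom_def c mult_pres_class h)
    show "h (pres_class R [(g, True)]) = f g" for g
      using assms(1) by (simp add: h eval_word_def)
  qed
qed

end

section \<open>Homomorphisms prescribed on generators\<close>

text \<open>\<open>V\<close> lists the prescribed values as pairs (element, value). The description is proper
  whenever the first components generate \<open>G\<close> and a homomorphism with these values exists;
  extensionality pins down the irrelevant values outside the carrier.\<close>

definition hom_with_values ::
  "('a, 'x) monoid_scheme \<Rightarrow> ('b, 'y) monoid_scheme \<Rightarrow> ('a \<times> 'b) set \<Rightarrow> 'a \<Rightarrow> 'b" where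
  "hom_with_values G H V =
    (THE h. h \<in> hom G H \<and> h \<in> extensional (carrier G) \<and> (\<forall>(g, m)\<in>V. h g = m))"

lemma hom_with_values:
  assumes G: "group G" and H: "group H" and gen: "carrier G \<subseteq> generate G (fst ` V)"
    and V: "fst ` V \<subseteq> carrier G"
    and h: "h \<in> hom G H" "\<And>g m. (g, m) \<in> V \<Longrightarrow> h g = m"
  shows "hom_with_values G H V \<in> hom G H"
    and "(g, m) \<in> V \<Longrightarrow> hom_with_values G H V g = m"
proof -
  interpret G: group G by fact
  interpret H: group H by fact
  let ?P = "\<lambda>h. h \<in> hom G H \<and> h \<in> extensional (carrier G) \<and> (\<forall>(g, m)\<in>V. h g = m)"
  have eq_on_V: "h' x = h x" "x \<in> carrier G" if P: "?P h'" and x: "x \<in> fst ` V" for h' x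
  proof -
    obtain m where m: "(x, m) \<in> V" using x by auto
    then have "h' x = m" using P by auto
    with h(2)[OF m] show "h' x = h x" by simp
    show "x \<in> carrier G" using x V by blast
  qed
  have "\<exists>!h. ?P h"
  proof (rule ex1I)
    have "restrict h (carrier G) g = m" if "(g, m) \<in> V" for g m
    proof -
      have "g \<in> carrier G" using that V by force
      then show ?thesis using h(2)[OF that] by simp
    qed
    moreover have "restrict h (carrier G) \<in> hom G H" using h(1) by (auto simp: hom_def)
    ultimately show "?P (restrict h (carrier G))" by auto
  next
    fix h' assume h': "?P h'"
    then have hom': "h' \<in> hom G H" by blast
    have "h' x = h x" if "x \<in> generate G (fst ` V)" for x
      using that
    proof induction
      case one
      then show ?case using hom_one[OF h(1) G H] hom_one[OF hom' G H] by simp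
    next
      case (incl x)
      then show ?case using eq_on_V(1)[OF h'] by blast
    next
      case (inv x)
      have gh: "group_hom G H h" "group_hom G H h'"
        using h(1) hom' G H by (auto simp: group_hom_def group_hom_axioms_def)
      show ?case
        using group_hom.hom_inv[OF gh(1)] group_hom.hom_inv[OF gh(2)] eq_on_V[OF h' inv] by simp
    next
      case (eng x y)
      then have "x \<in> carrier G" "y \<in> carrier G" using G.generate_in_carrier V by blast+
      then show ?case using eng h(1) hom' by (simp add: hom_def)
    qed
    then have eq: "h' x = h x" if "x \<in> carrier G" for x using gen that by blast
    show "h' = restrict h (carrier G)"
    proof
      fix x show "h' x = restrict h (carrier G) x"
        using h' eq[of x] by (cases "x \<in> carrier G") (auto simp: extensional_def)
    qed
  qed
  then have "?P (hom_with_values G H V)"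
    unfolding hom_with_values_def by (rule theI')
  then show "hom_with_values G H V \<in> hom G H"
    and "(g, m) \<in> V \<Longrightarrow> hom_with_values G H V g = m" by auto
qed

section \<open>The welded braid group on three strings\<close>

datatype wb3_gen = A1 | A2 | S1 | S2

abbreviation wb3_word :: "wb3_gen list \<Rightarrow> wb3_gen word" where
  "wb3_word gs \<equiv> map (\<lambda>g. (g, True)) gs"

definition WB3_rels :: "(wb3_gen word \<times> wb3_gen word) set" where
  "WB3_rels =
    {(wb3_word [A1, A1], []),
     (wb3_word [A2, A2], []),
     (wb3_word [A1, A2, A1], wb3_word [A2, A1, A2]),
     (wb3_word [S1, S2, S1], wb3_word [S2, S1, S2]),
     (wb3_word [A1, A2, S1], wb3_word [S2, A1, A2]),
     (wb3_word [S1, S2, A1], wb3_word [A2, S1, S2])}"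

type_synonym wb3 = "wb3_gen word set"

definition WB3 :: "wb3 monoid" where "WB3 = presented_group WB3_rels"

definition wb3_of_gen :: "wb3_gen \<Rightarrow> wb3" where
  "wb3_of_gen g = pres_class WB3_rels [(g, True)]"

definition alpha1 :: wb3 where "alpha1 = wb3_of_gen A1"
definition alpha2 :: wb3 where "alpha2 = wb3_of_gen A2"
definition sigma1 :: wb3 where "sigma1 = wb3_of_gen S1"
definition sigma2 :: wb3 where "sigma2 = wb3_of_gen S2"

definition B3 :: "wb3 monoid" where "B3 = subgroup_generated WB3 {sigma1, sigma2}"

lemma group_WB3: "group WB3"
  unfolding WB3_def by (rule group_presented_group)

lemma group_B3: "group B3"
  unfolding B3_def using group_WB3 by (rule group.group_subgroup_generated)

lemma generators_in_WB3: "{alpha1, alpha2, sigma1, sigma2} \<subseteq> carrier WB3"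
  by (auto simp: alpha1_def alpha2_def sigma1_def sigma2_def wb3_of_gen_def WB3_def
      presented_group_def)

lemma carrier_WB3: "carrier WB3 = generate WB3 {alpha1, alpha2, sigma1, sigma2}"
proof
  interpret group WB3 by (rule group_WB3)
  let ?S = "{alpha1, alpha2, sigma1, sigma2}"
  have c: "carrier WB3 = range (pres_class WB3_rels)"
    and o: "\<one>\<^bsub>WB3\<^esub> = pres_class WB3_rels []"
    and m: "pres_class WB3_rels u \<otimes>\<^bsub>WB3\<^esub> pres_class WB3_rels v = pres_class WB3_rels (u @ v)" for u v
    by (simp_all add: WB3_def mult_pres_class) (simp_all add: presented_group_def)
  have "pres_class WB3_rels w \<in> generate WB3 ?S" for w
  proof (induction w)
    case Nil
    then show ?case using generate.one[of WB3 ?S] by (simp add: o)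
  next
    case (Cons l w)
    obtain g e where l: "l = (g, e)" by (cases l)
    have g: "wb3_of_gen g \<in> ?S"
      by (cases g) (auto simp: alpha1_def alpha2_def sigma1_def sigma2_def)
    have "pres_class WB3_rels [(g, False)] \<otimes>\<^bsub>WB3\<^esub> wb3_of_gen g = \<one>\<^bsub>WB3\<^esub>"
      using pres_eq.cancel[of WB3_rels g False]
      by (simp add: wb3_of_gen_def m o pres_class_eq_iff)
    then have "inv\<^bsub>WB3\<^esub> wb3_of_gen g = pres_class WB3_rels [(g, False)]"
      by (intro inv_equality) (auto simp: c wb3_of_gen_def)
    then have "pres_class WB3_rels [l] \<in> generate WB3 ?S"
      using generate.incl[OF g, of WB3] generate.inv[OF g, of WB3]
      by (cases e) (auto simp: l wb3_of_gen_def)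
    from generate.eng[OF this Cons.IH] show ?case by (simp add: m)
  qed
  then show "carrier WB3 \<subseteq> generate WB3 ?S" by (auto simp: c)
  show "generate WB3 ?S \<subseteq> carrier WB3"
    by (rule generate_incl) (rule generators_in_WB3)
qed

lemma sigmas_in_B3: "{sigma1, sigma2} \<subseteq> carrier B3"
  using generators_in_WB3 by (auto simp: B3_def carrier_subgroup_generated intro: generate.incl)

lemma carrier_B3: "carrier B3 = generate B3 {sigma1, sigma2}"
proof -
  interpret group WB3 by (rule group_WB3)
  have s: "{sigma1, sigma2} \<subseteq> carrier WB3" using generators_in_WB3 by auto
  then have c: "carrier B3 = generate WB3 {sigma1, sigma2}"
    by (simp add: B3_def carrier_subgroup_generated Int_absorb1)
  have "B3 = WB3\<lparr>carrier := generate WB3 {sigma1, sigma2}\<rparr>"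
    using c by (simp add: B3_def subgroup_generated_def)
  then show ?thesis
    using c generate_consistent[OF _ generate_is_subgroup[OF s]] s
    by (metis generate.incl subsetI)
qed

lemma hom_WB3_B3: "h \<in> hom WB3 H \<Longrightarrow> h \<in> hom B3 H"
  using group.carrier_subgroup_generated_subset[OF group_WB3, of "{sigma1, sigma2}"]
  by (auto simp: hom_def B3_def Pi_iff subset_iff)

lemma WB3_hom_ex:
  assumes "group H" and "{a1, a2, s1, s2} \<subseteq> carrier H"
    and "a1 \<otimes>\<^bsub>H\<^esub> a1 = \<one>\<^bsub>H\<^esub>" "a2 \<otimes>\<^bsub>H\<^esub> a2 = \<one>\<^bsub>H\<^esub>"
    and "a1 \<otimes>\<^bsub>H\<^esub> (a2 \<otimes>\<^bsub>H\<^esub> a1) = a2 \<otimes>\<^bsub>H\<^esub> (a1 \<otimes>\<^bsub>H\<^esub> a2)"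
    and "s1 \<otimes>\<^bsub>H\<^esub> (s2 \<otimes>\<^bsub>H\<^esub> s1) = s2 \<otimes>\<^bsub>H\<^esub> (s1 \<otimes>\<^bsub>H\<^esub> s2)"
    and "a1 \<otimes>\<^bsub>H\<^esub> (a2 \<otimes>\<^bsub>H\<^esub> s1) = s2 \<otimes>\<^bsub>H\<^esub> (a1 \<otimes>\<^bsub>H\<^esub> a2)"
    and "s1 \<otimes>\<^bsub>H\<^esub> (s2 \<otimes>\<^bsub>H\<^esub> a1) = a2 \<otimes>\<^bsub>H\<^esub> (s1 \<otimes>\<^bsub>H\<^esub> s2)"
  obtains h where "h \<in> hom WB3 H" "h alpha1 = a1" "h alpha2 = a2" "h sigma1 = s1" "h sigma2 = s2"
proof -
  interpret H: group H by fact
  define f where "f g = (case g of A1 \<Rightarrow> a1 | A2 \<Rightarrow> a2 | S1 \<Rightarrow> s1 | S2 \<Rightarrow> s2)" for g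
  have f: "f g \<in> carrier H" for g using assms(2) by (cases g) (auto simp: f_def)
  have r: "eval_word H f u = eval_word H f v" if "(u, v) \<in> WB3_rels" for u v
    using that assms by (auto simp: WB3_rels_def eval_word_def f_def)
  obtain h where "h \<in> hom (presented_group WB3_rels) H"
    and hf: "\<And>g. h (pres_class WB3_rels [(g, True)]) = f g"
    using H.presented_group_hom[of f WB3_rels, OF f r] by blast
  then show thesis
    by (intro that[of h])
      (auto simp: WB3_def alpha1_def alpha2_def sigma1_def sigma2_def wb3_of_gen_def f_def)
qed

section \<open>Representations\<close>

definition GL3 :: "(complex^3^3) monoid" where
  "GL3 = \<lparr>carrier = {A. invertible A}, mult = (**), one = mat 1\<rparr>"

definition Cstar :: "complex monoid" where
  "Cstar = \<lparr>carrier = UNIV - {0}, mult = (*), one = 1\<rparr>"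

definition equivalent_reps ::
  "('a, 'x) monoid_scheme \<Rightarrow> ('a \<Rightarrow> complex^3^3) \<Rightarrow> ('a \<Rightarrow> complex^3^3) \<Rightarrow> bool" where
  "equivalent_reps G \<rho> \<rho>' \<longleftrightarrow>
    (\<exists>P\<in>carrier GL3. \<forall>g\<in>carrier G. \<rho>' g = P ** \<rho> g ** matrix_inv P)"

text \<open>The tensor product of a one-dimensional with a three-dimensional representation, as the
  Kronecker product of matrices.\<close>

definition tensor_char :: "('a \<Rightarrow> complex) \<Rightarrow> ('a \<Rightarrow> complex^3^3) \<Rightarrow> 'a \<Rightarrow> complex^3^3" where
  "tensor_char X \<rho> g = (\<chi> i j. X g * \<rho> g $ i $ j)"

lemma group_GL3: "group GL3"
proof (rule groupI)
  fix A assume "A \<in> carrier GL3"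
  then obtain B where "A ** B = mat 1" "B ** A = mat 1"
    by (auto simp: GL3_def invertible_def)
  then show "\<exists>B\<in>carrier GL3. B \<otimes>\<^bsub>GL3\<^esub> A = \<one>\<^bsub>GL3\<^esub>"
    by (intro bexI[of _ B]) (auto simp: GL3_def invertible_def)
next
  show "\<one>\<^bsub>GL3\<^esub> \<in> carrier GL3"
    by (auto simp: GL3_def invertible_def)
qed (simp_all add: GL3_def invertible_mult matrix_mul_assoc)

lemma group_Cstar: "group Cstar"
proof (rule groupI)
  fix x assume "x \<in> carrier Cstar"
  then show "\<exists>y\<in>carrier Cstar. y \<otimes>\<^bsub>Cstar\<^esub> x = \<one>\<^bsub>Cstar\<^esub>"
    by (intro bexI[of _ "inverse x"]) (auto simp: Cstar_def)
qed (auto simp: Cstar_def)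

text \<open>The character $X_3(1,k)$.\<close>

definition X3_1 :: "complex \<Rightarrow> wb3 \<Rightarrow> complex" where
  "X3_1 k = hom_with_values WB3 Cstar {(sigma1, 1), (sigma2, 1), (alpha1, k), (alpha2, k)}"

text \<open>\<open>vector [r1, r2, r3]\<close> is the matrix with rows \<open>r1, r2, r3\<close>.\<close>

definition tau3_sigma1 :: "complex \<Rightarrow> complex^3^3" where
  "tau3_sigma1 z = vector [vector [0, z, 0], vector [1, 0, 0], vector [0, 0, 1]]"

definition tau3_sigma2 :: "complex \<Rightarrow> complex^3^3" where
  "tau3_sigma2 z = vector [vector [1, 0, 0], vector [0, 0, z], vector [0, 1, 0]]"

definition tau3 :: "complex \<Rightarrow> wb3 \<Rightarrow> complex^3^3" where
  "tau3 z = hom_with_values B3 GL3 {(sigma1, tau3_sigma1 z), (sigma2, tau3_sigma2 z)}"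

text \<open>The extension $\widetilde{\tau}_3(z,l)$ of $\tau_3(z)$ to the welded braid group.\<close>

definition tau3_ext :: "complex \<Rightarrow> complex \<Rightarrow> wb3 \<Rightarrow> complex^3^3" where
  "tau3_ext z l = hom_with_values WB3 GL3
    {(sigma1, tau3_sigma1 z), (sigma2, tau3_sigma2 z),
     (alpha1, vector [vector [0, 1 / l, 0], vector [l, 0, 0], vector [0, 0, 1]]),
     (alpha2, vector [vector [1, 0, 0], vector [0, 0, 1 / l], vector [0, l, 0]])}"

text \<open>Replacing this root by its conjugate amounts to replacing \<open>l\<close> by its inverse in
  \<open>psi3\<close>.\<close>

definition omega :: complex where "omega = cis (2 * pi / 3)"

definition psi3 :: "complex \<Rightarrow> complex \<Rightarrow> complex \<Rightarrow> wb3 \<Rightarrow> complex^3^3" where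
  "psi3 z l x =
    (let a = omega / 3 * l + 1 / 3 + omega^2 / 3 * inverse l;
         b = 1 / 3 * l + 1 / 3 + 1 / 3 * inverse l;
         c = omega^2 / 3 * l + 1 / 3 + omega / 3 * inverse l
     in hom_with_values WB3 GL3
       {(sigma1, tau3_sigma1 z), (sigma2, tau3_sigma2 z),
        (alpha1, vector [vector [a, b / x, c / x^2],
                         vector [x * b, c, a / x],
                         vector [x^2 * c, x * a, b]]),
        (alpha2, vector [vector [b, c / x, a / x^2],
                         vector [x * c, a, b / x],
                         vector [x^2 * a, x * b, c]])})"

subsection \<open>Well-definedness\<close>

lemma hom_with_values_WB3:
  assumes "group H" and "{a1, a2, s1, s2} \<subseteq> carrier H"
    and "a1 \<otimes>\<^bsub>H\<^esub> a1 = \<one>\<^bsub>H\<^esub>" "a2 \<otimes>\<^bsub>H\<^esub> a2 = \<one>\<^bsub>H\<^esub>"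
    and "a1 \<otimes>\<^bsub>H\<^esub> (a2 \<otimes>\<^bsub>H\<^esub> a1) = a2 \<otimes>\<^bsub>H\<^esub> (a1 \<otimes>\<^bsub>H\<^esub> a2)"
    and "s1 \<otimes>\<^bsub>H\<^esub> (s2 \<otimes>\<^bsub>H\<^esub> s1) = s2 \<otimes>\<^bsub>H\<^esub> (s1 \<otimes>\<^bsub>H\<^esub> s2)"
    and "a1 \<otimes>\<^bsub>H\<^esub> (a2 \<otimes>\<^bsub>H\<^esub> s1) = s2 \<otimes>\<^bsub>H\<^esub> (a1 \<otimes>\<^bsub>H\<^esub> a2)"
    and "s1 \<otimes>\<^bsub>H\<^esub> (s2 \<otimes>\<^bsub>H\<^esub> a1) = a2 \<otimes>\<^bsub>H\<^esub> (s1 \<otimes>\<^bsub>H\<^esub> s2)"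
  defines "h \<equiv> hom_with_values WB3 H {(sigma1, s1), (sigma2, s2), (alpha1, a1), (alpha2, a2)}"
  shows "h \<in> hom WB3 H" "h sigma1 = s1" "h sigma2 = s2" "h alpha1 = a1" "h alpha2 = a2"
proof -
  obtain h0 where h0: "h0 \<in> hom WB3 H"
    "h0 alpha1 = a1" "h0 alpha2 = a2" "h0 sigma1 = s1" "h0 sigma2 = s2"
    using assms(1-8) by (rule WB3_hom_ex)
  let ?V = "{(sigma1, s1), (sigma2, s2), (alpha1, a1), (alpha2, a2)}"
  have img: "fst ` ?V = {alpha1, alpha2, sigma1, sigma2}" by auto
  note w = hom_with_values[OF group_WB3 \<open>group H\<close>, of ?V h0, unfolded img,
      OF carrier_WB3[THEN equalityD1] generators_in_WB3 h0(1)]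
  show "h \<in> hom WB3 H" "h sigma1 = s1" "h sigma2 = s2" "h alpha1 = a1" "h alpha2 = a2"
    unfolding h_def by (rule w; use h0 in auto)+
qed

lemmas mat3_simps = GL3_def matrix_matrix_mult_def vec_eq_iff forall_3 sum_3 mat_def

lemma invertible_tau3:
  assumes "z \<noteq> 0"
  shows "invertible (tau3_sigma1 z)" "invertible (tau3_sigma2 z)"
proof -
  show "invertible (tau3_sigma1 z)"
    unfolding invertible_def using assms
    by (intro exI[of _ "vector [vector [0, 1, 0], vector [1 / z, 0, 0], vector [0, 0, 1]]"])
      (simp add: mat3_simps tau3_sigma1_def)
  show "invertible (tau3_sigma2 z)"
    unfolding invertible_def using assms
    by (intro exI[of _ "vector [vector [1, 0, 0], vector [0, 0, 1], vector [0, 1 / z, 0]]"])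
      (simp add: mat3_simps tau3_sigma2_def)
qed

lemma tau3_ext:
  assumes "z \<noteq> 0" "l \<noteq> 0"
  shows "tau3_ext z l \<in> hom WB3 GL3"
    and "tau3_ext z l sigma1 = tau3_sigma1 z" "tau3_ext z l sigma2 = tau3_sigma2 z"
    and "tau3_ext z l alpha1 = vector [vector [0, 1 / l, 0], vector [l, 0, 0], vector [0, 0, 1]]"
    and "tau3_ext z l alpha2 = vector [vector [1, 0, 0], vector [0, 0, 1 / l], vector [0, l, 0]]"
proof -
  let ?a1 = "vector [vector [0, 1 / l, 0], vector [l, 0, 0], vector [0, 0, 1]] :: complex^3^3"
  let ?a2 = "vector [vector [1, 0, 0], vector [0, 0, 1 / l], vector [0, l, 0]] :: complex^3^3"
  have sq: "?a1 ** ?a1 = mat 1" "?a2 ** ?a2 = mat 1"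
    using assms by (simp_all add: mat3_simps)
  then have "invertible ?a1" "invertible ?a2" unfolding invertible_def by blast+
  then have "{?a1, ?a2, tau3_sigma1 z, tau3_sigma2 z} \<subseteq> carrier GL3"
    using invertible_tau3[OF assms(1)] by (simp add: GL3_def)
  note * = hom_with_values_WB3[OF group_GL3 this]
  show "tau3_ext z l \<in> hom WB3 GL3"
    and "tau3_ext z l sigma1 = tau3_sigma1 z" "tau3_ext z l sigma2 = tau3_sigma2 z"
    and "tau3_ext z l alpha1 = ?a1" "tau3_ext z l alpha2 = ?a2"
    unfolding tau3_ext_def
    by (rule *; use assms sq in \<open>simp add: mat3_simps tau3_sigma1_def tau3_sigma2_def\<close>)+
qed

lemma tau3:
  assumes "z \<noteq> 0"
  shows "tau3 z \<in> hom B3 GL3"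
    and "tau3 z sigma1 = tau3_sigma1 z" "tau3 z sigma2 = tau3_sigma2 z"
proof -
  let ?V = "{(sigma1, tau3_sigma1 z), (sigma2, tau3_sigma2 z)}"
  have img: "fst ` ?V = {sigma1, sigma2}" by auto
  note t = tau3_ext[OF assms, of 1, simplified]
  note w = hom_with_values[OF group_B3 group_GL3, of ?V "tau3_ext z 1", unfolded img,
      OF carrier_B3[THEN equalityD1] sigmas_in_B3 hom_WB3_B3[OF t(1)]]
  show "tau3 z \<in> hom B3 GL3"
    and "tau3 z sigma1 = tau3_sigma1 z" "tau3 z sigma2 = tau3_sigma2 z"
    unfolding tau3_def by (rule w; use t in auto)+
qed

lemma X3_1:
  assumes "k \<in> {-1, 1}"
  shows "X3_1 k \<in> hom WB3 Cstar"
    and "X3_1 k sigma1 = 1" "X3_1 k sigma2 = 1" "X3_1 k alpha1 = k" "X3_1 k alpha2 = k"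
proof -
  have "{k, k, 1, 1} \<subseteq> carrier Cstar" using assms by (auto simp: Cstar_def)
  note * = hom_with_values_WB3[OF group_Cstar this]
  show "X3_1 k \<in> hom WB3 Cstar"
    and "X3_1 k sigma1 = 1" "X3_1 k sigma2 = 1" "X3_1 k alpha1 = k" "X3_1 k alpha2 = k"
    unfolding X3_1_def by (rule *; use assms in \<open>auto simp: Cstar_def\<close>)+
qed

lemma omega: "omega^2 + omega + 1 = 0" "omega^3 = 1"
proof -
  have o: "omega = Complex (- 1 / 2) (sqrt 3 / 2)"
    unfolding omega_def cis.ctr by (simp only: cos_120 sin_120)
  show 1: "omega^2 + omega + 1 = 0"
    by (simp add: o complex_eq_iff power2_eq_square)
  have "omega^3 - 1 = (omega - 1) * (omega^2 + omega + 1)" by algebra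
  then show "omega^3 = 1" by (simp add: 1)
qed

lemma psi3:
  assumes "z \<noteq> 0" "l \<noteq> 0" "x \<noteq> 0" "x^3 = 1 / z^2"
  defines "a \<equiv> omega / 3 * l + 1 / 3 + omega^2 / 3 * inverse l"
    and "b \<equiv> 1 / 3 * l + 1 / 3 + 1 / 3 * inverse l"
    and "c \<equiv> omega^2 / 3 * l + 1 / 3 + omega / 3 * inverse l"
  shows "psi3 z l x \<in> hom WB3 GL3"
    and "psi3 z l x sigma1 = tau3_sigma1 z" "psi3 z l x sigma2 = tau3_sigma2 z"
    and "psi3 z l x alpha1 = vector [vector [a, b / x, c / x^2],
           vector [x * b, c, a / x], vector [x^2 * c, x * a, b]]"
    and "psi3 z l x alpha2 = vector [vector [b, c / x, a / x^2],
           vector [x * c, a, b / x], vector [x^2 * a, x * b, c]]"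
proof -
  let ?a1 = "vector [vector [a, b / x, c / x^2],
      vector [x * b, c, a / x], vector [x^2 * c, x * a, b]] :: complex^3^3"
  let ?a2 = "vector [vector [b, c / x, a / x^2],
      vector [x * c, a, b / x], vector [x^2 * a, x * b, c]] :: complex^3^3"
  let ?p = "vector [vector [0, 0, 1 / x^2], vector [x, 0, 0], vector [0, x, 0]] :: complex^3^3"
  define m where "m = inverse l"
  have lm: "l * m = 1" using assms by (simp add: m_def)
  have a: "3 * a = omega * l + 1 + omega^2 * m" and b: "3 * b = l + 1 + m"
    and c: "3 * c = omega^2 * l + 1 + omega * m"
    by (simp_all add: a_def b_def c_def m_def field_simps)
  have "9 * (a * b + b * c + c * a) = 0"
    using a b c lm omega by algebra
  then have e1: "a * b + b * c + c * a = 0" by (simp only: mult_eq_0_iff) simp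
  have "9 * (a^2 + b^2 + c^2 - 1) = 0"
    using a b c lm omega by algebra
  then have e2: "a^2 + b^2 + c^2 = 1" by (simp only: mult_eq_0_iff) simp
  have x0: "x \<noteq> 0" by fact
  have xz: "x * x * x * z * z = 1"
    using assms by (simp add: power2_eq_square power3_eq_cube)
  have sq: "?a1 ** ?a1 = mat 1" "?a2 ** ?a2 = mat 1"
    using x0 e1 e2 by (simp_all add: mat3_simps field_simps; algebra)+
  have p: "?a1 ** ?a2 = ?p"
    using x0 e1 e2 by (simp add: mat3_simps field_simps; algebra)
  have "invertible ?a1" "invertible ?a2" using sq unfolding invertible_def by blast+
  then have "{?a1, ?a2, tau3_sigma1 z, tau3_sigma2 z} \<subseteq> carrier GL3"
    using invertible_tau3[OF assms(1)] by (simp add: GL3_def)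
  note * = hom_with_values_WB3[OF group_GL3 this]
  have r1: "?a1 ** (?a2 ** ?a1) = ?a2 ** (?a1 ** ?a2)"
    unfolding matrix_mul_assoc[of ?a1] p using x0 by (simp add: mat3_simps field_simps)
  have r2: "tau3_sigma1 z ** (tau3_sigma2 z ** tau3_sigma1 z) =
      tau3_sigma2 z ** (tau3_sigma1 z ** tau3_sigma2 z)"
    by (simp add: mat3_simps tau3_sigma1_def tau3_sigma2_def)
  have r3: "?a1 ** (?a2 ** tau3_sigma1 z) = tau3_sigma2 z ** (?a1 ** ?a2)"
    unfolding matrix_mul_assoc[of ?a1] p
    using x0 xz by (simp add: mat3_simps tau3_sigma1_def tau3_sigma2_def field_simps; algebra?)
  have r4: "tau3_sigma1 z ** (tau3_sigma2 z ** ?a1) = ?a2 ** (tau3_sigma1 z ** tau3_sigma2 z)"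
    using x0 xz by (simp add: mat3_simps tau3_sigma1_def tau3_sigma2_def field_simps; algebra?)
  show "psi3 z l x \<in> hom WB3 GL3"
    and "psi3 z l x sigma1 = tau3_sigma1 z" "psi3 z l x sigma2 = tau3_sigma2 z"
    and "psi3 z l x alpha1 = ?a1" "psi3 z l x alpha2 = ?a2"
    unfolding psi3_def Let_def a_def[symmetric] b_def[symmetric] c_def[symmetric]
    by (rule *; use sq r1 r2 r3 r4 in \<open>simp add: GL3_def\<close>)+
qed

end

theory Submission
  imports Defs
begin

text \<open>The braid relations leave no freedom in the conjugating matrix: for \<open>z \<noteq> 1\<close> only scalar
  matrices commute with both \<open>tau3_sigma1 z\<close> and \<open>tau3_sigma2 z\<close> (\<open>commutant_tau3\<close>). Hence, once
  $\rho$ has been conjugated so that it restricts to $\tau_3(z)$, it is equivalent to another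
  extension of $\tau_3(z)$ only if the two are equal (\<open>equivalent_extension_iff\<close>), and the theorem
  becomes a classification of pairs of matrices $(X, Y)$, the images of $\alpha_1, \alpha_2$.

  The key to the classification (\<open>welded_extension_matrices\<close>) is the product $T = XY$. It satisfies
  $T^3 = 1$ and $T\sigma_1 = \sigma_2 T$, and for \<open>z \<noteq> 1\<close> this already forces $T$ to be the
  cyclic permutation matrix conjugated by the diagonal matrix with entries $1, x, x^2$, for some
  \<open>x \<noteq> 0\<close>. The involution $X$ inverts $T$, so up to the same conjugation it has entries depending only on $i + j$ modulo 3:
  it is given by three numbers $a, b, c$. The relation $X^2 = 1$ says that
  $a^2 + b^2 + c^2 = 1$ and $ab + bc + ca = 0$; a discrete Fourier transform of order 3 turns this
  curve into two copies of $\mathbb{C}^*$, with parameters $k = a + b + c = \pm 1$ and $\lambda$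
  (\<open>fourier_coordinates\<close>). The last mixed relation holds iff $x^3 z^2 = 1$ or $a = c = 0$, and
  $a = c = 0$ means $\lambda = 1$.

  So all extensions lie in one family with parameters $(k, x, \lambda)$: the
  representations $X_3(1,k) \otimes \psi_3(z,\lambda;x)$ fill the part $x^3 = 1/z^2$ and
  $X_3(1,k) \otimes \widetilde{\tau}_3(z,x)$ the part $\lambda = 1$. The three parameters can be
  read off from $(X, Y)$ (\<open>welded_pair_inject\<close>), which gives uniqueness in both cases, and
  the condition \<open>\<lambda> \<noteq> 1\<close> keeps the cases apart.\<close>

section \<open>Matrices of size three\<close>

lemma matrix3_eq_iff:
  "(A :: complex^3^3) = B \<longleftrightarrow>
    A$1$1 = B$1$1 \<and> A$1$2 = B$1$2 \<and> A$1$3 = B$1$3 \<and>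
    A$2$1 = B$2$1 \<and> A$2$2 = B$2$2 \<and> A$2$3 = B$2$3 \<and>
    A$3$1 = B$3$1 \<and> A$3$2 = B$3$2 \<and> A$3$3 = B$3$3"
  by (auto simp: vec_eq_iff forall_3)

lemma matrix3_mult_nth:
  "((A :: complex^3^3) ** B) $ i $ j = A$i$1 * B$1$j + A$i$2 * B$2$j + A$i$3 * B$3$j"
  by (simp add: matrix_matrix_mult_def sum_3)

lemmas matrix3_simps = matrix3_eq_iff matrix3_mult_nth mat_def

lemma mat_scalar_mult_nth: "(mat k ** M) $ i $ j = k * (M :: complex^3^3) $ i $ j"
  using exhaust_3[of i] by (auto simp: matrix3_mult_nth mat_def)

lemma mat_scalar_commute: "mat k ** M = (M :: complex^3^3) ** mat k"
  by (simp add: matrix3_simps)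

lemma mat_scalar_mult_mat: "mat k ** mat l = (mat (k * l) :: complex^3^3)"
  by (simp add: matrix3_simps)

lemma mat_scalar_mult_mult:
  fixes A B :: "complex^3^3"
  shows "mat c ** A ** (mat d ** B) = mat (c * d) ** (A ** B)"
proof -
  have "mat c ** A ** (mat d ** B) = mat c ** (A ** mat d) ** B"
    by (simp only: matrix_mul_assoc)
  also have "\<dots> = mat (c * d) ** (A ** B)"
    by (simp only: mat_scalar_commute[of d A, symmetric] matrix_mul_assoc mat_scalar_mult_mat)
  finally show ?thesis .
qed

lemma invertible_mat_scalar: "k \<noteq> 0 \<Longrightarrow> invertible (mat k :: complex^3^3)"
  unfolding invertible_def by (intro exI[of _ "mat (1 / k)"]) (simp add: mat_scalar_mult_mat)

lemma matrix_inv_cancel: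
  assumes "invertible (P :: complex^3^3)"
  shows "P ** matrix_inv P = mat 1" "matrix_inv P ** P = mat 1"
    "M ** P ** matrix_inv P = M" "M ** matrix_inv P ** P = M"
proof -
  show 1: "P ** matrix_inv P = mat 1" "matrix_inv P ** P = mat 1"
    using assms someI_ex[of "\<lambda>A'. P ** A' = mat 1 \<and> A' ** P = mat 1"]
    unfolding invertible_def matrix_inv_def by blast+
  show "M ** P ** matrix_inv P = M" "M ** matrix_inv P ** P = M"
    using 1 by (metis matrix_mul_assoc matrix_mul_rid)+
qed

lemma conj_eq_iff:
  assumes "invertible (P :: complex^3^3)"
  shows "N = P ** M ** matrix_inv P \<longleftrightarrow> N ** P = P ** M"
  by (metis assms matrix_inv_cancel(3,4))

section \<open>Representations of the welded braid group\<close>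

lemma hom_GL3_D:
  assumes "\<rho> \<in> hom G GL3"
  shows "x \<in> carrier G \<Longrightarrow> invertible (\<rho> x)"
    and "x \<in> carrier G \<Longrightarrow> y \<in> carrier G \<Longrightarrow> \<rho> (x \<otimes>\<^bsub>G\<^esub> y) = \<rho> x ** \<rho> y"
  using assms by (auto simp: hom_def GL3_def)

lemma conj_hom_GL3:
  assumes \<rho>: "\<rho> \<in> hom G GL3" and P: "invertible P"
  shows "(\<lambda>g. P ** \<rho> g ** matrix_inv P) \<in> hom G GL3"
proof -
  have "invertible (matrix_inv P)"
    using matrix_inv_cancel[OF P] unfolding invertible_def by blast
  moreover have "P ** (A ** B) ** matrix_inv P =
      P ** A ** matrix_inv P ** (P ** B ** matrix_inv P)" for A B :: "complex^3^3"
    by (simp add: matrix_mul_assoc matrix_inv_cancel[OF P])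
  ultimately show ?thesis
    using hom_GL3_D[OF \<rho>] P
    by (auto simp: hom_def GL3_def intro!: invertible_mult)
qed

lemma tensor_char_eq: "tensor_char X \<rho> g = mat (X g) ** \<rho> g"
  by (simp add: tensor_char_def vec_eq_iff mat_scalar_mult_nth)

lemma tensor_char_hom:
  assumes X: "X \<in> hom G Cstar" and \<rho>: "\<rho> \<in> hom G GL3"
  shows "tensor_char X \<rho> \<in> hom G GL3"
proof -
  have "X g \<noteq> 0" if "g \<in> carrier G" for g using X that by (auto simp: hom_def Cstar_def)
  then show ?thesis
    using X hom_GL3_D[OF \<rho>]
    by (auto simp: tensor_char_eq mat_scalar_mult_mult hom_def Cstar_def GL3_def
        intro!: invertible_mult invertible_mat_scalar)
qed

lemma hom_WB3_eqI:
  assumes H: "group H" and h: "h \<in> hom WB3 H" and h': "h' \<in> hom WB3 H"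
    and eq: "\<And>g. g \<in> {alpha1, alpha2, sigma1, sigma2} \<Longrightarrow> h g = h' g"
    and x: "x \<in> carrier WB3"
  shows "h x = h' x"
  using x unfolding carrier_WB3
proof induction
  case one
  then show ?case using hom_one[OF h group_WB3 H] hom_one[OF h' group_WB3 H] by simp
next
  case (incl x)
  then show ?case by (rule eq)
next
  case (inv x)
  have gh: "group_hom WB3 H h" "group_hom WB3 H h'"
    using h h' group_WB3 H by (auto simp: group_hom_def group_hom_axioms_def)
  show ?case
    using group_hom.hom_inv[OF gh(1)] group_hom.hom_inv[OF gh(2)] eq[OF inv] inv
      generators_in_WB3 by auto
next
  case (eng x y)
  then show ?case using h h' by (simp add: hom_def carrier_WB3)
qed

lemma WB3_relations:
  "alpha1 \<otimes>\<^bsub>WB3\<^esub> alpha1 = \<one>\<^bsub>WB3\<^esub>"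
  "alpha2 \<otimes>\<^bsub>WB3\<^esub> alpha2 = \<one>\<^bsub>WB3\<^esub>"
  "alpha1 \<otimes>\<^bsub>WB3\<^esub> alpha2 \<otimes>\<^bsub>WB3\<^esub> alpha1 = alpha2 \<otimes>\<^bsub>WB3\<^esub> alpha1 \<otimes>\<^bsub>WB3\<^esub> alpha2"
  "alpha1 \<otimes>\<^bsub>WB3\<^esub> alpha2 \<otimes>\<^bsub>WB3\<^esub> sigma1 = sigma2 \<otimes>\<^bsub>WB3\<^esub> alpha1 \<otimes>\<^bsub>WB3\<^esub> alpha2"
  "sigma1 \<otimes>\<^bsub>WB3\<^esub> sigma2 \<otimes>\<^bsub>WB3\<^esub> alpha1 = alpha2 \<otimes>\<^bsub>WB3\<^esub> sigma1 \<otimes>\<^bsub>WB3\<^esub> sigma2"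
proof -
  have o: "\<one>\<^bsub>WB3\<^esub> = pres_class WB3_rels []"
    by (simp add: WB3_def presented_group_def)
  show "alpha1 \<otimes>\<^bsub>WB3\<^esub> alpha1 = \<one>\<^bsub>WB3\<^esub>"
    "alpha2 \<otimes>\<^bsub>WB3\<^esub> alpha2 = \<one>\<^bsub>WB3\<^esub>"
    "alpha1 \<otimes>\<^bsub>WB3\<^esub> alpha2 \<otimes>\<^bsub>WB3\<^esub> alpha1 = alpha2 \<otimes>\<^bsub>WB3\<^esub> alpha1 \<otimes>\<^bsub>WB3\<^esub> alpha2"
    "alpha1 \<otimes>\<^bsub>WB3\<^esub> alpha2 \<otimes>\<^bsub>WB3\<^esub> sigma1 = sigma2 \<otimes>\<^bsub>WB3\<^esub> alpha1 \<otimes>\<^bsub>WB3\<^esub> alpha2"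
    "sigma1 \<otimes>\<^bsub>WB3\<^esub> sigma2 \<otimes>\<^bsub>WB3\<^esub> alpha1 = alpha2 \<otimes>\<^bsub>WB3\<^esub> sigma1 \<otimes>\<^bsub>WB3\<^esub> sigma2"
    unfolding o unfolding WB3_def alpha1_def alpha2_def sigma1_def sigma2_def wb3_of_gen_def
      mult_pres_class pres_class_eq_iff
    by (rule pres_eq.relation; simp add: WB3_rels_def)+
qed

lemma WB3_hom_relations:
  assumes h: "h \<in> hom WB3 GL3"
  shows "h alpha1 ** h alpha1 = mat 1" "h alpha2 ** h alpha2 = mat 1"
    "h alpha1 ** h alpha2 ** h alpha1 = h alpha2 ** h alpha1 ** h alpha2"
    "h alpha1 ** h alpha2 ** h sigma1 = h sigma2 ** h alpha1 ** h alpha2"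
    "h sigma1 ** h sigma2 ** h alpha1 = h alpha2 ** h sigma1 ** h sigma2"
proof -
  interpret group WB3 by (rule group_WB3)
  have g: "alpha1 \<in> carrier WB3" "alpha2 \<in> carrier WB3"
    "sigma1 \<in> carrier WB3" "sigma2 \<in> carrier WB3"
    using generators_in_WB3 by auto
  have one: "h \<one>\<^bsub>WB3\<^esub> = mat 1"
    using hom_one[OF h group_WB3 group_GL3] by (simp add: GL3_def)
  note mult = hom_GL3_D(2)[OF h, symmetric]
  show "h alpha1 ** h alpha1 = mat 1" "h alpha2 ** h alpha2 = mat 1"
    "h alpha1 ** h alpha2 ** h alpha1 = h alpha2 ** h alpha1 ** h alpha2"
    "h alpha1 ** h alpha2 ** h sigma1 = h sigma2 ** h alpha1 ** h alpha2"
    "h sigma1 ** h sigma2 ** h alpha1 = h alpha2 ** h sigma1 ** h sigma2"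
    by (simp_all add: mult g one WB3_relations)
qed

section \<open>Rigidity of the standard representation\<close>

text \<open>Comparing entries shows that every entry of \<open>M\<close> off the diagonal equals \<open>z\<close> times itself. For
  \<open>z = 1\<close> the two matrices are permutation matrices, and the all-ones matrix commutes with them.\<close>

lemma commutant_tau3:
  assumes z: "z \<noteq> 0" "z \<noteq> 1"
    and 1: "M ** tau3_sigma1 z = tau3_sigma1 z ** M"
    and 2: "M ** tau3_sigma2 z = tau3_sigma2 z ** M"
  shows "M = mat (M $ 1 $ 1)"
proof -
  note e1 = 1[unfolded tau3_sigma1_def matrix3_simps, simplified]
  note e2 = 2[unfolded tau3_sigma2_def matrix3_simps, simplified]
  have eqs: "M $ 1 $ 3 = M $ 1 $ 2" "M $ 1 $ 2 * z = M $ 1 $ 3" "M $ 2 $ 3 = M $ 1 $ 3"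
    "M $ 3 $ 2 = M $ 3 $ 1" "M $ 3 $ 1 * z = M $ 3 $ 2" "M $ 3 $ 1 = M $ 2 $ 1"
    "M $ 2 $ 2 = M $ 1 $ 1" "M $ 3 $ 3 = M $ 2 $ 2"
    using e1 e2 by blast+
  then have "M $ 1 $ 2 * z = M $ 1 $ 2" "M $ 3 $ 1 * z = M $ 3 $ 1" by metis+
  then have "M $ 1 $ 2 = 0" "M $ 3 $ 1 = 0" using z by simp_all
  with eqs show ?thesis by (simp add: matrix3_eq_iff mat_def)
qed

text \<open>If \<open>Q\<close> conjugates \<open>\<rho>\<close> to \<open>\<rho>'\<close>, then \<open>Q ** matrix_inv P\<close> commutes with the images of the braid
  generators. So \<open>Q\<close> is a scalar multiple of \<open>P\<close>, and both conjugate \<open>\<rho>\<close> in the same way.\<close>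

lemma equivalent_extension_iff:
  assumes z: "z \<noteq> 0" "z \<noteq> 1" and \<rho>: "\<rho> \<in> hom WB3 GL3" and \<rho>': "\<rho>' \<in> hom WB3 GL3"
    and P: "invertible P"
    and s: "P ** \<rho> sigma1 ** matrix_inv P = tau3_sigma1 z"
           "P ** \<rho> sigma2 ** matrix_inv P = tau3_sigma2 z"
    and s': "\<rho>' sigma1 = tau3_sigma1 z" "\<rho>' sigma2 = tau3_sigma2 z"
  shows "equivalent_reps WB3 \<rho> \<rho>' \<longleftrightarrow>
    P ** \<rho> alpha1 ** matrix_inv P = \<rho>' alpha1 \<and> P ** \<rho> alpha2 ** matrix_inv P = \<rho>' alpha2"
proof
  assume "equivalent_reps WB3 \<rho> \<rho>'"
  then obtain Q where Q: "invertible Q"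
    and eq: "\<And>g. g \<in> carrier WB3 \<Longrightarrow> \<rho>' g = Q ** \<rho> g ** matrix_inv Q"
    by (auto simp: equivalent_reps_def GL3_def)
  define M where "M = Q ** matrix_inv P"
  have comm: "M ** S = S ** M" if "S = P ** R ** matrix_inv P" "S = Q ** R ** matrix_inv Q" for R S
  proof -
    have "M ** S = Q ** R ** matrix_inv P"
      unfolding that(1) M_def by (simp add: matrix_mul_assoc matrix_inv_cancel[OF P])
    also have "\<dots> = S ** M"
      unfolding that(2) M_def by (simp add: matrix_mul_assoc matrix_inv_cancel[OF Q])
    finally show ?thesis .
  qed
  have "M ** tau3_sigma1 z = tau3_sigma1 z ** M" "M ** tau3_sigma2 z = tau3_sigma2 z ** M"
    by (rule comm; use s s' eq[of sigma1] eq[of sigma2] generators_in_WB3 in simp)+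
  then obtain c where "M = mat c" using commutant_tau3[OF z] by blast
  then have Qc: "Q = P ** mat c"
    using matrix_inv_cancel(4)[OF P, of Q] by (simp add: M_def mat_scalar_commute)
  have "P ** R ** matrix_inv P = Q ** R ** matrix_inv Q" for R
  proof -
    have "P ** R ** matrix_inv P ** Q = P ** (R ** mat c)"
      by (simp add: Qc matrix_mul_assoc matrix_inv_cancel[OF P])
    also have "\<dots> = Q ** R"
      by (simp only: Qc mat_scalar_commute[symmetric] matrix_mul_assoc)
    finally show ?thesis by (simp only: conj_eq_iff[OF Q])
  qed
  then show "P ** \<rho> alpha1 ** matrix_inv P = \<rho>' alpha1 \<and>
      P ** \<rho> alpha2 ** matrix_inv P = \<rho>' alpha2"
    using eq generators_in_WB3 by simp
next
  assume a: "P ** \<rho> alpha1 ** matrix_inv P = \<rho>' alpha1 \<and>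
    P ** \<rho> alpha2 ** matrix_inv P = \<rho>' alpha2"
  have "\<rho>' g = P ** \<rho> g ** matrix_inv P" if "g \<in> carrier WB3" for g
    by (rule hom_WB3_eqI[OF group_GL3 \<rho>' conj_hom_GL3[OF \<rho> P] _ that]) (use a s s' in auto)
  then show "equivalent_reps WB3 \<rho> \<rho>'"
    using P by (auto simp: equivalent_reps_def GL3_def)
qed

section \<open>Matrices extending the standard representation\<close>

text \<open>For \<open>x = 1\<close> the entries depend only on $i + j$ modulo 3; these are the matrices $B$ with
  $CBC = B$ for the cyclic permutation matrix $C$. In general they are conjugated by the diagonal
  matrix with entries $1, x, x^2$.\<close>

definition anticirculant :: "complex \<Rightarrow> complex \<Rightarrow> complex \<Rightarrow> complex \<Rightarrow> complex^3^3" where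
  "anticirculant x a b c = vector [vector [a, b / x, c / x^2],
                                   vector [x * b, c, a / x],
                                   vector [x^2 * c, x * a, b]]"

lemma mat_scalar_mult_anticirculant:
  "mat k ** anticirculant x a b c = anticirculant x (k * a) (k * b) (k * c)"
  by (simp add: matrix3_eq_iff mat_scalar_mult_nth anticirculant_def)

lemma anticirculant_product_nth:
  assumes "x \<noteq> 0" and "a^2 + b^2 + c^2 = 1"
  shows "(anticirculant x a b c ** anticirculant x b c a) $ 2 $ 1 = x"
proof -
  have "(anticirculant x a b c ** anticirculant x b c a) $ 2 $ 1 = x * (a^2 + b^2 + c^2)"
    using assms(1) by (simp add: anticirculant_def matrix3_mult_nth field_simps power2_eq_square)
  then show ?thesis using assms(2) by simp
qed

text \<open>The welded relations are solved through the product \<open>X ** Y\<close>: the relation with \<open>tau3_sigma1\<close>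
  is linear in it, and $(XY)^3 = (XYX)^2 = 1$ by the braid relation. Once this product is known,
  \<open>Y\<close> is determined by \<open>X\<close>.\<close>

lemma welded_extension_matrices:
  assumes z: "z \<noteq> 0" "z \<noteq> 1"
    and sq: "X ** X = mat 1" "Y ** Y = mat 1"
    and braid: "X ** Y ** X = Y ** X ** Y"
    and mixed1: "X ** Y ** tau3_sigma1 z = tau3_sigma2 z ** X ** Y"
    and mixed2: "tau3_sigma1 z ** tau3_sigma2 z ** X = Y ** tau3_sigma1 z ** tau3_sigma2 z"
  obtains x a b c where "x \<noteq> 0" "X = anticirculant x a b c" "Y = anticirculant x b c a"
    "a^2 + b^2 + c^2 = 1" "a * b + b * c + c * a = 0" "x^3 * z^2 = 1 \<or> a = 0 \<and> c = 0"
proof -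
  define T where "T = X ** Y"
  have lin: "T ** tau3_sigma1 z = tau3_sigma2 z ** T"
    using mixed1 by (simp add: T_def matrix_mul_assoc)
  have cancel: "M ** X ** X = M" "M ** Y ** Y = M" for M :: "complex^3^3"
    using sq by (metis matrix_mul_assoc matrix_mul_rid)+
  have "T ** T ** T = (X ** Y ** X) ** (Y ** X ** Y)"
    by (simp add: T_def matrix_mul_assoc)
  also have "\<dots> = (X ** Y ** X) ** (X ** Y ** X)"
    by (simp only: braid)
  also have "\<dots> = mat 1" by (simp add: matrix_mul_assoc cancel sq)
  finally have T3: "T ** T ** T = mat 1" .
  note e = lin[unfolded tau3_sigma1_def tau3_sigma2_def matrix3_simps, simplified]
  have T_zero: "T $ 1 $ 1 = 0" "T $ 1 $ 2 = 0" "T $ 2 $ 3 = 0" "T $ 3 $ 3 = 0"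
    using e z by (metis mult_cancel_left2 mult_cancel_right2)+
  have T_eq: "T $ 3 $ 2 = T $ 2 $ 1" "T $ 2 $ 2 = z * T $ 3 $ 1"
    using e by simp_all
  define x where "x = T $ 2 $ 1"
  \<comment> \<open>The first two entries of the first row of $T^3$.\<close>
  have T13: "T $ 1 $ 3 * x^2 = 1" and "T $ 1 $ 3 * x * (z * T $ 3 $ 1) = 0"
    using T3 unfolding matrix3_simps by (simp_all add: T_zero T_eq x_def power2_eq_square mult.assoc)
  then have T31: "T $ 3 $ 1 = 0" and x0: "x \<noteq> 0" using z by auto
  have T: "T = vector [vector [0, 0, 1 / x^2], vector [x, 0, 0], vector [0, x, 0]]"
    using T_zero T_eq T13 T31 x0 by (simp add: matrix3_eq_iff x_def field_simps)
  have Y: "Y = X ** T"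
    by (simp add: T_def matrix_mul_assoc sq)
  \<comment> \<open>The involution \<open>X\<close> conjugates \<open>T\<close> to its inverse; entry by entry this says that \<open>X\<close> is
    anticirculant.\<close>
  have TXT: "T ** X ** T = X"
    by (simp add: T_def matrix_mul_assoc cancel)
  define a b c where "a = X $ 1 $ 1" and "b = X $ 3 $ 3" and "c = X $ 2 $ 2"
  note eX = TXT[unfolded T matrix3_simps, simplified]
  have "X $ 1 $ 2 = b / x" "X $ 1 $ 3 = c / x^2" "X $ 2 $ 1 = x * b"
    "X $ 2 $ 3 = a / x" "X $ 3 $ 1 = x^2 * c" "X $ 3 $ 2 = x * a"
  proof -
    have "X $ 3 $ 3 * x / x^2 = X $ 1 $ 2" "x * X $ 1 $ 3 * x = X $ 2 $ 2"
      "x * X $ 2 $ 1 / x^2 = X $ 3 $ 3" "x * X $ 1 $ 1 / x^2 = X $ 2 $ 3"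
      "x * X $ 2 $ 2 * x = X $ 3 $ 1" "X $ 3 $ 2 * x / x^2 = X $ 1 $ 1"
      using eX by blast+
    then show "X $ 1 $ 2 = b / x" "X $ 1 $ 3 = c / x^2" "X $ 2 $ 1 = x * b"
        "X $ 2 $ 3 = a / x" "X $ 3 $ 1 = x^2 * c" "X $ 3 $ 2 = x * a"
      using x0 unfolding a_def b_def c_def by (simp_all add: field_simps power2_eq_square)
  qed
  then have Xc: "X = anticirculant x a b c"
    by (simp add: matrix3_eq_iff anticirculant_def a_def b_def c_def)
  have Yc: "Y = anticirculant x b c a"
    using x0 unfolding Y Xc T
    by (simp add: anticirculant_def matrix3_simps field_simps power2_eq_square)
  note eq = sq(1)[unfolded Xc anticirculant_def matrix3_simps, simplified]
  have "a * a + (if x = 0 then 0 else b * b) + (if x = 0 then 0 else c * c) = 1"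
    "a * b / x + b * c / x + c * (x * a) / x^2 = 0"
    using eq by blast+
  then have q: "a^2 + b^2 + c^2 = 1" "a * b + b * c + c * a = 0"
    using x0 by (simp_all add: power2_eq_square field_simps)
  \<comment> \<open>The cube of \<open>tau3_sigma1 z ** tau3_sigma2 z\<close> is $z^2$, whence the power of \<open>z\<close>.\<close>
  note em = mixed2[unfolded Xc Yc anticirculant_def tau3_sigma1_def tau3_sigma2_def matrix3_simps,
      simplified]
  have "z * z * (x^2 * c) = c / x" "z * z * (x * a) = a / x^2"
    using em by blast+
  then have "(x^3 * z^2 - 1) * c = 0" "(x^3 * z^2 - 1) * a = 0"
    using x0 by (simp_all add: field_simps power2_eq_square power3_eq_cube)
  then have "x^3 * z^2 = 1 \<or> a = 0 \<and> c = 0" by auto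
  then show thesis using that x0 Xc Yc q by blast
qed

text \<open>A discrete Fourier transform of order 3: the values at \<open>omega * u\<close>, \<open>u\<close> and \<open>omega^2 * u\<close> have
  the Fourier coefficients \<open>u\<close>, \<open>1\<close> and \<open>inverse u\<close>.\<close>

definition trisection :: "complex \<Rightarrow> complex" where
  "trisection u = (u + 1 + inverse u) / 3"

lemma trisection_omega:
  "trisection (omega * u) = (omega * u + 1 + omega^2 * inverse u) / 3"
  "trisection (omega^2 * u) = (omega^2 * u + 1 + omega * inverse u) / 3"
proof -
  have "omega * omega^2 = 1" using omega(2) by (simp add: power2_eq_square power3_eq_cube mult.assoc)
  then have "inverse omega = omega^2" by (rule inverse_unique)
  moreover from this have "inverse (omega^2) = omega" by (metis inverse_inverse_eq)
  ultimately show "trisection (omega * u) = (omega * u + 1 + omega^2 * inverse u) / 3"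
    "trisection (omega^2 * u) = (omega^2 * u + 1 + omega * inverse u) / 3"
    by (simp_all add: trisection_def inverse_mult_distrib)
qed

lemma trisection_sums:
  "trisection (omega * u) + trisection u + trisection (omega^2 * u) = 1"
  "trisection u + omega^2 * trisection (omega * u) + omega * trisection (omega^2 * u) = u"
  "u \<noteq> 0 \<Longrightarrow>
    (trisection (omega * u))^2 + (trisection u)^2 + (trisection (omega^2 * u))^2 = 1"
proof -
  define v where "v = inverse u"
  have t: "3 * trisection (omega * u) = omega * u + 1 + omega^2 * v"
    "3 * trisection u = u + 1 + v" "3 * trisection (omega^2 * u) = omega^2 * u + 1 + omega * v"
    unfolding trisection_omega by (simp_all add: trisection_def v_def)
  have "3 * (trisection (omega * u) + trisection u + trisection (omega^2 * u)) = 3 * 1"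
    using t omega by algebra
  then show "trisection (omega * u) + trisection u + trisection (omega^2 * u) = 1"
    by (simp only: mult_cancel_left) simp
  have "3 * (trisection u + omega^2 * trisection (omega * u) + omega * trisection (omega^2 * u))
      = 3 * u"
    using t omega by algebra
  then show "trisection u + omega^2 * trisection (omega * u) + omega * trisection (omega^2 * u) = u"
    by (simp only: mult_cancel_left) simp
  assume "u \<noteq> 0"
  then have "u * v = 1" by (simp add: v_def)
  then have "9 * ((trisection (omega * u))^2 + (trisection u)^2 + (trisection (omega^2 * u))^2) = 9 * 1"
    using t omega by algebra
  then show "(trisection (omega * u))^2 + (trisection u)^2 + (trisection (omega^2 * u))^2 = 1"
    by (simp only: mult_cancel_left) simp
qed

text \<open>The two equations say that $(a+b+c)^2 = 1$ and that the other two Fourier coefficients of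
  $(a, b, c)$ have product 1.\<close>

lemma fourier_coordinates:
  assumes q: "a^2 + b^2 + c^2 = 1" "a * b + b * c + c * a = 0"
  obtains k l where "k \<in> {-1, 1}" "l \<noteq> 0" "a = k * trisection (omega * l)"
    "b = k * trisection l" "c = k * trisection (omega^2 * l)"
proof -
  define k where "k = a + b + c"
  define l where "l = k * (b + omega^2 * a + omega * c)"
  define m where "m = k * (b + omega * a + omega^2 * c)"
  have k2: "k^2 = 1" using q unfolding k_def by algebra
  then have k: "k \<in> {-1, 1}" by (auto simp: power2_eq_1_iff)
  have lm: "l * m = 1" using q k2 omega unfolding l_def m_def by algebra
  then have l0: "l \<noteq> 0" and m: "inverse l = m" by (auto intro: inverse_unique)
  have "3 * a = k * (omega * l + 1 + omega^2 * m)" "3 * b = k * (l + 1 + m)"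
    "3 * c = k * (omega^2 * l + 1 + omega * m)"
    using k2 omega k_def unfolding l_def m_def by algebra+
  then have "a = k * trisection (omega * l)" "b = k * trisection l"
    "c = k * trisection (omega^2 * l)"
    unfolding trisection_omega by (simp_all add: trisection_def m eq_divide_eq mult.commute)
  then show thesis using that k l0 by blast
qed

section \<open>The common family of extensions\<close>

definition welded_involution :: "complex \<Rightarrow> complex \<Rightarrow> complex^3^3" where
  "welded_involution x u =
    anticirculant x (trisection (omega * u)) (trisection u) (trisection (omega^2 * u))"

text \<open>The candidates for the images of \<open>alpha1\<close> and \<open>alpha2\<close>. The second matrix is the first one
  with its three parameters permuted: multiplying \<open>l\<close> by \<open>omega^2\<close> shifts the values of \<open>trisection\<close>
  cyclically.\<close>

definition welded_pair :: "complex \<Rightarrow> complex \<Rightarrow> complex \<Rightarrow> (complex^3^3) \<times> (complex^3^3)" where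
  "welded_pair k x l =
    (mat k ** welded_involution x l, mat k ** welded_involution x (omega^2 * l))"

lemma welded_involution_omega:
  "welded_involution x (omega^2 * l) =
    anticirculant x (trisection l) (trisection (omega^2 * l)) (trisection (omega * l))"
proof -
  have "omega * (omega^2 * l) = l" "omega^2 * (omega^2 * l) = omega * l"
    using omega(2) by algebra+
  then show ?thesis by (simp only: welded_involution_def)
qed

text \<open>The product of the two matrices determines \<open>x\<close>, the trace of the first one is \<open>k\<close>, and then
  \<open>l\<close> is a Fourier coefficient of the entries.\<close>

lemma welded_pair_inject:
  assumes k: "k \<in> {-1, 1}" "k' \<in> {-1, 1}" and x: "x \<noteq> 0" "x' \<noteq> 0" and l: "l \<noteq> 0" "l' \<noteq> 0"
    and eq: "welded_pair k x l = welded_pair k' x' l'"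
  shows "k = k' \<and> x = x' \<and> l = l'"
proof -
  let ?X = "\<lambda>k x l. mat k ** welded_involution x l"
  let ?Y = "\<lambda>k x l. mat k ** welded_involution x (omega^2 * l)"
  have x_eq: "(?X k x l ** ?Y k x l) $ 2 $ 1 = x" if "k \<in> {-1, 1}" "x \<noteq> 0" "l \<noteq> 0" for k x l
  proof -
    have "?X k x l ** ?Y k x l = welded_involution x l ** welded_involution x (omega^2 * l)"
      using that(1) by (auto simp: mat_scalar_mult_mult)
    then show ?thesis
      using anticirculant_product_nth[OF that(2) trisection_sums(3)[OF that(3)]]
      by (simp add: welded_involution_omega) (simp add: welded_involution_def)
  qed
  have k_eq: "?X k x l $ 1 $ 1 + ?X k x l $ 2 $ 2 + ?X k x l $ 3 $ 3 = k" for k x l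
  proof -
    have "?X k x l $ 1 $ 1 + ?X k x l $ 2 $ 2 + ?X k x l $ 3 $ 3 =
        k * (trisection (omega * l) + trisection l + trisection (omega^2 * l))"
      by (simp add: mat_scalar_mult_nth welded_involution_def anticirculant_def algebra_simps)
    then show ?thesis by (simp only: trisection_sums mult_1_right)
  qed
  have XY: "?X k x l = ?X k' x' l'" "?Y k x l = ?Y k' x' l'"
    using eq by (simp_all add: welded_pair_def)
  have kk: "k = k'" using k_eq[of k x l] k_eq[of k' x' l'] XY(1) by simp
  have xx: "x = x'" using x_eq[of k x l] x_eq[of k' x' l'] XY k x l by simp
  have "k \<noteq> 0" using k by auto
  then have W: "welded_involution x l = welded_involution x l'"
    using XY(1) unfolding kk[symmetric] xx[symmetric]
    by (simp add: matrix3_eq_iff mat_scalar_mult_nth)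
  have diag: "welded_involution x u $ 1 $ 1 = trisection (omega * u)"
    "welded_involution x u $ 3 $ 3 = trisection u"
    "welded_involution x u $ 2 $ 2 = trisection (omega^2 * u)" for u
    by (simp_all add: welded_involution_def anticirculant_def)
  have t: "trisection (omega * l) = trisection (omega * l')" "trisection l = trisection l'"
    "trisection (omega^2 * l) = trisection (omega^2 * l')"
    using diag[of l, unfolded W] diag[of l'] by simp_all
  have "l = trisection l + omega^2 * trisection (omega * l) + omega * trisection (omega^2 * l)"
    by (rule trisection_sums(2)[symmetric])
  also have "\<dots> = l'"
    unfolding t by (rule trisection_sums(2))
  finally have "l = l'" .
  then show ?thesis using kk xx by simp
qed

text \<open>At \<open>l = 1\<close> the three values of \<open>trisection\<close> are $0, 1, 0$, and the parameter of the family
  \<open>tau3_ext\<close> turns into the diagonal conjugation \<open>x\<close>.\<close>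

lemma tau3_ext_alphas:
  assumes "z \<noteq> 0" "l \<noteq> 0"
  shows "tau3_ext z l alpha1 = welded_involution l 1"
    and "tau3_ext z l alpha2 = welded_involution l (omega^2 * 1)"
proof -
  have "omega + 1 + omega^2 = 0" "omega^2 + 1 + omega = 0"
    using omega(1) by (simp_all add: add_ac)
  then have t: "trisection (omega * 1) = 0" "trisection (omega^2 * 1) = 0"
    unfolding trisection_omega by simp_all
  have t1: "trisection 1 = 1" by (simp add: trisection_def)
  show "tau3_ext z l alpha1 = welded_involution l 1"
    unfolding tau3_ext(4)[OF assms] welded_involution_def anticirculant_def t t1 by simp
  show "tau3_ext z l alpha2 = welded_involution l (omega^2 * 1)"
    unfolding tau3_ext(5)[OF assms] welded_involution_omega anticirculant_def t t1 by simp
qed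

lemma psi3_alphas:
  assumes "z \<noteq> 0" "l \<noteq> 0" "x \<noteq> 0" "x^3 = 1 / z^2"
  shows "psi3 z l x alpha1 = welded_involution x l"
    and "psi3 z l x alpha2 = welded_involution x (omega^2 * l)"
proof -
  have t: "omega / 3 * l + 1 / 3 + omega^2 / 3 * inverse l = trisection (omega * l)"
    "1 / 3 * l + 1 / 3 + 1 / 3 * inverse l = trisection l"
    "omega^2 / 3 * l + 1 / 3 + omega / 3 * inverse l = trisection (omega^2 * l)"
    unfolding trisection_omega by (simp_all add: trisection_def add_divide_distrib)
  show "psi3 z l x alpha1 = welded_involution x l"
    unfolding psi3(4)[OF assms] t welded_involution_def anticirculant_def by simp
  show "psi3 z l x alpha2 = welded_involution x (omega^2 * l)"
    unfolding psi3(5)[OF assms] t welded_involution_omega anticirculant_def by simp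
qed

section \<open>The classification\<close>

lemma welded_pair_exists:
  assumes z: "z \<noteq> 0" "z \<noteq> 1" and h: "h \<in> hom WB3 GL3"
    and s: "h sigma1 = tau3_sigma1 z" "h sigma2 = tau3_sigma2 z"
  obtains k x l where "k \<in> {-1, 1}" "x \<noteq> 0" "l \<noteq> 0" "(h alpha1, h alpha2) = welded_pair k x l"
    "x^3 = 1 / z^2 \<or> l = 1"
proof -
  note rels = WB3_hom_relations[OF h, unfolded s]
  obtain x a b c where x: "x \<noteq> 0"
    and X: "h alpha1 = anticirculant x a b c" and Y: "h alpha2 = anticirculant x b c a"
    and q: "a^2 + b^2 + c^2 = 1" "a * b + b * c + c * a = 0"
    and y: "x^3 * z^2 = 1 \<or> a = 0 \<and> c = 0"
    using welded_extension_matrices[OF z rels] by metis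
  obtain k l where k: "k \<in> {-1, 1}" and l: "l \<noteq> 0" and abc: "a = k * trisection (omega * l)"
    "b = k * trisection l" "c = k * trisection (omega^2 * l)"
    using fourier_coordinates[OF q] by metis
  have "(h alpha1, h alpha2) = welded_pair k x l"
    unfolding welded_pair_def welded_involution_omega
    unfolding welded_involution_def mat_scalar_mult_anticirculant X Y abc ..
  moreover have "x^3 = 1 / z^2 \<or> l = 1"
    using y
  proof
    assume "x^3 * z^2 = 1"
    then show ?thesis using z by (simp add: field_simps)
  next
    assume "a = 0 \<and> c = 0"
    then have "trisection (omega * l) = 0" "trisection (omega^2 * l) = 0"
      using abc k by auto
    then show ?thesis using trisection_sums(1,2)[of l] by simp
  qed
  ultimately show thesis using that k x l by blast
qed

theorem theorem5p9:
  fixes \<rho> :: "wb3 \<Rightarrow> complex^3^3" and z :: complex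
  assumes "\<rho> \<in> hom WB3 GL3"
    and "z \<noteq> 0" and "z \<noteq> 1"
    and "equivalent_reps B3 (restrict \<rho> (carrier B3)) (tau3 z)"
  shows
    "let case1 = (\<exists>!p. case p of (l, k) \<Rightarrow>
           l \<noteq> 0 \<and> k \<in> {-1, 1} \<and>
           equivalent_reps WB3 \<rho> (tensor_char (X3_1 k) (tau3_ext z l)));
         case2 = (\<exists>!p. case p of (l, k, x) \<Rightarrow>
           k \<in> {-1, 1} \<and> l \<noteq> 0 \<and> l \<noteq> 1 \<and> x \<noteq> 0 \<and> x^3 = 1 / z^2 \<and>
           equivalent_reps WB3 \<rho> (tensor_char (X3_1 k) (psi3 z l x)))
     in (case1 \<or> case2) \<and> \<not> (case1 \<and> case2)"
proof -
  note z = assms(2,3)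
  obtain P where P: "invertible P"
    and conj: "\<And>g. g \<in> carrier B3 \<Longrightarrow> tau3 z g = P ** \<rho> g ** matrix_inv P"
    using assms(4) by (auto simp: equivalent_reps_def GL3_def)
  define h where "h g = P ** \<rho> g ** matrix_inv P" for g
  have h: "h \<in> hom WB3 GL3"
    unfolding h_def by (rule conj_hom_GL3[OF assms(1) P])
  have s: "h sigma1 = tau3_sigma1 z" "h sigma2 = tau3_sigma2 z"
    using conj[of sigma1] conj[of sigma2] sigmas_in_B3 tau3[OF z(1)] by (auto simp: h_def)
  have rep_iff: "equivalent_reps WB3 \<rho> (tensor_char (X3_1 k) \<phi>) \<longleftrightarrow>
      (h alpha1, h alpha2) = (mat k ** \<phi> alpha1, mat k ** \<phi> alpha2)"
    if "k \<in> {-1, 1}" "\<phi> \<in> hom WB3 GL3" "\<phi> sigma1 = tau3_sigma1 z" "\<phi> sigma2 = tau3_sigma2 z"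
    for k \<phi>
    using equivalent_extension_iff[OF z assms(1) tensor_char_hom[OF X3_1(1)[OF that(1)] that(2)] P]
      s that by (simp add: h_def tensor_char_eq X3_1)
  have tau: "equivalent_reps WB3 \<rho> (tensor_char (X3_1 k) (tau3_ext z l)) \<longleftrightarrow>
      (h alpha1, h alpha2) = welded_pair k l 1" if "k \<in> {-1, 1}" "l \<noteq> 0" for k l
    using rep_iff[OF that(1) tau3_ext(1-3)[OF z(1) that(2)]] tau3_ext_alphas[OF z(1) that(2)]
    by (simp add: welded_pair_def)
  have psi: "equivalent_reps WB3 \<rho> (tensor_char (X3_1 k) (psi3 z l x)) \<longleftrightarrow>
      (h alpha1, h alpha2) = welded_pair k x l"
    if "k \<in> {-1, 1}" "l \<noteq> 0" "x \<noteq> 0" "x^3 = 1 / z^2" for k l x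
    using rep_iff[OF that(1) psi3(1-3)[OF z(1) that(2-4)]] psi3_alphas[OF z(1) that(2-4)]
    by (simp add: welded_pair_def)
  obtain k x l where kxl: "k \<in> {-1, 1}" "x \<noteq> 0" "l \<noteq> 0"
    and pair: "(h alpha1, h alpha2) = welded_pair k x l" and y: "x^3 = 1 / z^2 \<or> l = 1"
    using welded_pair_exists[OF z h s] by metis
  have unique: "(h alpha1, h alpha2) = welded_pair k' x' l' \<longleftrightarrow> k' = k \<and> x' = x \<and> l' = l"
    if "k' \<in> {-1, 1}" "x' \<noteq> 0" "l' \<noteq> 0" for k' x' l'
    using welded_pair_inject[OF kxl(1) that(1) kxl(2) that(2) kxl(3) that(3)] pair by auto
  \<comment> \<open>Each case has at most one solution, read off from \<open>k\<close>, \<open>x\<close>, \<open>l\<close>; it has one or none according to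
    whether \<open>l = 1\<close>.\<close>
  let ?P1 = "\<lambda>p. case p of (l, k) \<Rightarrow> l \<noteq> 0 \<and> k \<in> {-1, 1} \<and>
      equivalent_reps WB3 \<rho> (tensor_char (X3_1 k) (tau3_ext z l))"
  let ?P2 = "\<lambda>p. case p of (l, k, x) \<Rightarrow> k \<in> {-1, 1} \<and> l \<noteq> 0 \<and> l \<noteq> 1 \<and> x \<noteq> 0 \<and> x^3 = 1 / z^2 \<and>
      equivalent_reps WB3 \<rho> (tensor_char (X3_1 k) (psi3 z l x))"
  have P1: "?P1 (l', k') \<longleftrightarrow> l = 1 \<and> (l', k') = (x, k)" for l' k'
    using tau[of k' l'] unique[of k' l' 1] kxl by auto
  have P2: "?P2 (l', k', x') \<longleftrightarrow> l \<noteq> 1 \<and> (l', k', x') = (l, k, x)" for l' k' x'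
    using psi[of k' l' x'] unique[of k' x' l'] kxl y by auto
  have "(\<exists>!p. ?P1 p) \<longleftrightarrow> l = 1"
    using P1 by (auto simp: Ex1_def split_paired_All split_paired_Ex)
  moreover have "(\<exists>!p. ?P2 p) \<longleftrightarrow> l \<noteq> 1"
    using P2 by (auto simp: Ex1_def split_paired_All split_paired_Ex)
  ultimately show ?thesis by (simp only: Let_def) blast
qed

end
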